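(* Let $p$ be an odd prime and $q=p^r$ ($r\ge1$) with $q\equiv 1\pmod 4$. Then for $x\in\mathbb{F}_q$, $x\neq 0,\pm1$, \[ {_2}F_1\left(\begin{array}{cc}\chi_4, & \chi_4^3\\ & \varepsilon\end{array}\Big|\frac{(1-x)^2}{(1+x)^2}\right)_q=\varphi(-2)\varphi(1+x)\,{_2}F_1\left(\begin{array}{cc}\varphi, & \varphi\\ & \varepsilon\end{array}\Big|x\right)_q. \]
   Context: All multiplicative characters $\chi$ of $\mathbb{F}_q^\times$ (including the trivial character $\varepsilon$) are extended to $\mathbb{F}_q$ by $\chi(0)=0$. $\varphi$ is the quadratic character and $\chi_4$ a character of order $4$. For characters $A,B$, Greene's binomial coefficient is $\binom{A}{B}:=\frac{B(-1)}{q}\sum_{y\in\mathbb{F}_q}A(y)\overline{B}(1-y)$. Greene's hypergeometric function is \[ {_2}F_1\left(\begin{array}{cc}A_0, & A_1\\ & B_1\end{array}\Big|x\right)_q:=\frac{q}{q-1}\sum_{\chi}\binom{A_0\chi}{\chi}\binom{A_1\chi}{B_1\chi}\chi(x), \] the sum over all multiplicative characters $\chi$ of $\mathbb{F}_q^\times$. *)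

theory Defs
  imports Complex_Main "HOL-Library.Cardinality" "HOL-Number_Theory.Cong"
    "HOL-Computational_Algebra.Primes"
begin

text \<open>The finite field is a type of classes \<open>field\<close> and \<open>finite\<close>, with \<open>q = CARD('a)\<close>.
  A multiplicative character is a total function on the field, extended by zero at zero;
  this applies to the trivial character as well. Products and powers of characters are pointwise.\<close>

definition mult_char :: "('a::{field,finite} \<Rightarrow> complex) \<Rightarrow> bool" where
  "mult_char \<chi> \<longleftrightarrow> \<chi> 0 = 0 \<and> \<chi> 1 = 1 \<and> (\<forall>x y. \<chi> (x * y) = \<chi> x * \<chi> y)"

definition trivial_char :: "'a::{field,finite} \<Rightarrow> complex" where
  "trivial_char x = (if x = 0 then 0 else 1)"

definition quadratic_char :: "'a::{field,finite} \<Rightarrow> complex" where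
  "quadratic_char x = (if x = 0 then 0 else if \<exists>y. x = y\<^sup>2 then 1 else -1)"

definition char_order :: "('a::{field,finite} \<Rightarrow> complex) \<Rightarrow> nat" where
  "char_order \<chi> = (LEAST n. n > 0 \<and> (\<lambda>x. \<chi> x ^ n) = trivial_char)"

definition greene_binom :: "('a::{field,finite} \<Rightarrow> complex) \<Rightarrow> ('a \<Rightarrow> complex) \<Rightarrow> complex" where
  "greene_binom A B = B (-1) / of_nat CARD('a) * (\<Sum>y\<in>UNIV. A y * cnj (B (1 - y)))"

definition greene_2F1 ::
  "('a::{field,finite} \<Rightarrow> complex) \<Rightarrow> ('a \<Rightarrow> complex) \<Rightarrow> ('a \<Rightarrow> complex) \<Rightarrow> 'a \<Rightarrow> complex" where
  "greene_2F1 A0 A1 B1 x =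
     of_nat CARD('a) / (of_nat CARD('a) - 1) *
     (\<Sum>\<chi> | mult_char \<chi>.
        greene_binom (\<lambda>y. A0 y * \<chi> y) \<chi> * greene_binom (\<lambda>y. A1 y * \<chi> y) (\<lambda>y. B1 y * \<chi> y) * \<chi> x)"

text \<open>The sum above really ranges over a finite set, so it is not the default value \<open>0\<close>.\<close>

lemma finite_field_power_eq_1:
  fixes x :: "'a::{field,finite}"
  assumes "x \<noteq> 0"
  shows "x ^ (CARD('a) - 1) = 1"
proof -
  let ?U = "UNIV - {0::'a}"
  have bij: "bij_betw ((*) x) ?U ?U"
    by (rule bij_betw_byWitness[where f' = "\<lambda>y. y / x"]) (use assms in auto)
  have "(\<Prod>y\<in>?U. y) = (\<Prod>y\<in>?U. x * y)"
    using prod.reindex_bij_betw[OF bij, of "\<lambda>y. y"] by simp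
  also have "\<dots> = x ^ card ?U * (\<Prod>y\<in>?U. y)"
    by (simp add: prod.distrib)
  finally have "x ^ card ?U = 1" by simp
  then show ?thesis by (simp add: card_Diff_singleton)
qed

lemma finite_mult_chars: "finite {\<chi> :: 'a::{field,finite} \<Rightarrow> complex. mult_char \<chi>}"
proof -
  let ?R = "insert 0 {z::complex. z ^ (CARD('a) - 1) = 1}"
  have "card {0, 1::'a} \<le> CARD('a)"
    by (rule card_mono) auto
  then have "CARD('a) - 1 \<ge> 1" by simp
  then have fin: "finite ?R"
    using finite_roots_unity[of "CARD('a) - 1", where ?'a = complex] by simp
  have "\<chi> x \<in> ?R" if \<chi>: "mult_char \<chi>" for \<chi> :: "'a \<Rightarrow> complex" and x
  proof (cases "x = 0")
    case True
    then show ?thesis using \<chi> by (simp add: mult_char_def)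
  next
    case False
    have "\<chi> x ^ n = \<chi> (x ^ n)" for n
      by (induction n) (use \<chi> in \<open>auto simp: mult_char_def\<close>)
    then show ?thesis
      using finite_field_power_eq_1[OF False] \<chi> by (simp add: mult_char_def)
  qed
  then have "{\<chi> :: 'a \<Rightarrow> complex. mult_char \<chi>} \<subseteq> {f. \<forall>x. (x \<in> UNIV \<longrightarrow> f x \<in> ?R) \<and> (x \<notin> UNIV \<longrightarrow> f x = 0)}"
    by auto
  then show ?thesis
    by (rule finite_subset) (rule finite_set_of_finite_funs, use fin in auto)
qed

end

theory Submission
  imports Defs "HOL-Algebra.Multiplicative_Group"
begin

text \<open>Orthogonality of characters collapses the sum over \<open>\<chi>\<close>: for \<open>t \<noteq> 0\<close>, the function
  \<open>q \<cdot> 2F1(A, B; \<epsilon> | t)\<close> equals the sum of \<open>A(u / (1 + u)) B(1 / (1 + t u))\<close> over \<open>u\<close>.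
  Write \<open>t = (1 - x)\<^sup>2 / (1 + x)\<^sup>2\<close>. The left-hand sum is then that of
  \<open>\<chi>\<^sub>4(u (1 + t u) / (1 + u))\<close>. Counting the solutions \<open>u\<close> of \<open>u (1 + t u) / (1 + u) = w\<close> by the
  discriminant turns it into a sum over \<open>w\<close> of \<open>\<chi>\<^sub>4(w)\<^sup>3 \<phi>(w + 1/w + 4 t - 2)\<close>. Averaging over
  \<open>w \<mapsto> 1/w\<close> cancels the nonsquares and leaves \<open>w = s\<^sup>2\<close>, so only quadratic
  characters remain. In the variable \<open>m = s + 1/s\<close> the sum becomes that of
  \<open>\<phi>(m + 2) \<phi>(m\<^sup>2 - 4 (1 - t))\<close>, which counts points on a curve 2-isogenous, up to a quadratic
  twist, to \<open>y\<^sup>2 = n (n + 1) (n + x)\<close>; the latter curve also gives the right-hand side.\<close>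

section \<open>Cyclicity of the multiplicative group\<close>

lemma card_field_gt_1: "CARD('a::{field,finite}) > 1"
proof -
  have "card {0, 1::'a} \<le> CARD('a)"
    by (rule card_mono) auto
  then show ?thesis by simp
qed

lemma power_mod_exponent:
  fixes h :: "'a::monoid_mult"
  assumes "h ^ n = 1"
  shows "h ^ (i mod n) = h ^ i"
proof -
  have "h ^ i = h ^ (n * (i div n) + i mod n)" by simp
  also have "\<dots> = h ^ (i mod n)"
    by (simp only: power_add power_mult assms) simp
  finally show ?thesis ..
qed

text \<open>The cyclicity theorem speaks about fields given as records, so the type class structure
  is repackaged as the record \<open>R\<close>.\<close>

lemma finite_field_generator:
  obtains g :: "'a::{field,finite}"
  where "g \<noteq> 0" and "bij_betw (\<lambda>i. g ^ i) {..<CARD('a) - 1} (UNIV - {0})"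
proof -
  define R where "R = \<lparr>carrier = UNIV :: 'a set, monoid.mult = (*), one = (1::'a), zero = (0::'a), add = (+)\<rparr>"
  have R: "field R"
  proof (rule cring.cring_fieldI2)
    show "cring R"
      by (rule cringI, rule abelian_groupI, auto simp: R_def algebra_simps
           intro!: comm_monoidI exI[of _ "- _"])
    show "\<zero>\<^bsub>R\<^esub> \<noteq> \<one>\<^bsub>R\<^esub>" by (simp add: R_def)
    show "\<exists>b\<in>carrier R. a \<otimes>\<^bsub>R\<^esub> b = \<one>\<^bsub>R\<^esub>" if "a \<noteq> \<zero>\<^bsub>R\<^esub>" for a
      by (rule bexI[of _ "inverse a"]) (use that in \<open>auto simp: R_def\<close>)
  qed
  have pow: "x [^]\<^bsub>R\<^esub> (i::nat) = x ^ i" for x i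
    by (induction i) (simp_all add: R_def nat_pow_def)
  obtain g :: 'a where g0: "g \<noteq> 0" and gen: "UNIV - {0} = range (\<lambda>i. g ^ i)"
  proof -
    have "carrier R = UNIV" "\<zero>\<^bsub>R\<^esub> = 0" by (simp_all add: R_def)
    then have "\<exists>a\<in>UNIV - {0::'a}. UNIV - {0} = {a ^ i | i. i \<in> (UNIV :: nat set)}"
      using field.finite_field_mult_group_has_gen[OF R] by (simp add: pow)
    then obtain a :: 'a where "a \<noteq> 0" "UNIV - {0} = {a ^ i | i. i \<in> (UNIV :: nat set)}"
      by auto
    then show ?thesis by (intro that[of a]) (simp_all add: full_SetCompr_eq)
  qed
  let ?n = "CARD('a) - 1"
  have n: "?n > 0" using card_field_gt_1[where ?'a = 'a] by simp
  have "(\<lambda>i. g ^ i) ` {..<?n} = UNIV - {0}"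
  proof (intro equalityI subsetI)
    fix y :: 'a assume "y \<in> UNIV - {0}"
    then obtain i where "y = g ^ i" unfolding gen by blast
    \<comment> \<open>Exponents reduce modulo \<open>?n\<close>, so \<open>?n\<close> powers already
      reach every nonzero element; equal cardinalities then give injectivity.\<close>
    then have "y = g ^ (i mod ?n)"
      using power_mod_exponent[OF finite_field_power_eq_1[OF g0]] by simp
    then show "y \<in> (\<lambda>i. g ^ i) ` {..<?n}" using n by simp
  qed (use g0 in auto)
  moreover from this have "inj_on (\<lambda>i. g ^ i) {..<?n}"
    by (intro eq_card_imp_inj_on) (simp_all add: card_Diff_singleton)
  ultimately show ?thesis
    using that[of g] g0 by (simp add: bij_betw_def)
qed

section \<open>Multiplicative characters and their orthogonality\<close>

lemma mult_char_0 [simp]: "mult_char \<chi> \<Longrightarrow> \<chi> 0 = 0"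
  and mult_char_1 [simp]: "mult_char \<chi> \<Longrightarrow> \<chi> 1 = 1"
  and mult_char_mult: "mult_char \<chi> \<Longrightarrow> \<chi> (x * y) = \<chi> x * \<chi> y"
  by (simp_all add: mult_char_def)

lemma mult_char_power:
  assumes "mult_char \<chi>"
  shows "\<chi> (x ^ n) = \<chi> x ^ n"
  by (induction n) (use assms in \<open>auto simp: mult_char_mult\<close>)

lemma mult_char_power_card:
  fixes \<chi> :: "'a::{field,finite} \<Rightarrow> complex"
  assumes "mult_char \<chi>" and "x \<noteq> 0"
  shows "\<chi> x ^ (CARD('a) - 1) = 1"
  using finite_field_power_eq_1[OF assms(2)] assms(1) by (metis mult_char_1 mult_char_power)

lemma mult_char_eq_0_iff:
  assumes "mult_char \<chi>"
  shows "\<chi> x = 0 \<longleftrightarrow> x = 0"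
  using mult_char_power_card[OF assms, of x] assms card_field_gt_1[where ?'a = 'a]
  by (cases "x = 0") (auto simp: power_0_left)

lemma mult_char_inverse:
  assumes "mult_char \<chi>"
  shows "\<chi> (inverse x) = inverse (\<chi> x)"
proof (cases "x = 0")
  case False
  then have "\<chi> x * \<chi> (inverse x) = 1"
    using assms by (simp flip: mult_char_mult)
  then show ?thesis by (metis inverse_unique)
qed (use assms in simp)

lemma mult_char_divide:
  assumes "mult_char \<chi>"
  shows "\<chi> (x / y) = \<chi> x / \<chi> y"
  using assms by (simp add: divide_inverse mult_char_mult mult_char_inverse)

text \<open>Nonzero values are roots of unity, hence of modulus 1; at zero both sides are
  \<open>0\<close> because \<open>inverse 0 = 0\<close>.\<close>

lemma mult_char_cnj:
  fixes \<chi> :: "'a::{field,finite} \<Rightarrow> complex"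
  assumes "mult_char \<chi>"
  shows "cnj (\<chi> x) = inverse (\<chi> x)"
proof (cases "x = 0")
  case False
  have "cmod (\<chi> x) ^ (CARD('a) - 1) = 1"
    using mult_char_power_card[OF assms False] by (metis norm_one norm_power)
  then have "cmod (\<chi> x) = 1"
    using card_field_gt_1[where ?'a = 'a] by (metis norm_ge_zero power_eq_1_iff zero_less_diff less_numeral_extra(3) real_norm_def abs_of_nonneg)
  then have "\<chi> x * cnj (\<chi> x) = 1"
    by (simp add: complex_norm_square[symmetric])
  then show ?thesis by (metis inverse_unique)
qed (use assms in simp)

text \<open>A character is determined by its value at a generator, which can be any root of unity
  of order dividing \<open>q - 1\<close>.\<close>

lemma sum_mult_chars:
  fixes u :: "'a::{field,finite}"
  shows "(\<Sum>\<chi> | mult_char \<chi>. \<chi> u) = (if u = 1 then of_nat CARD('a) - 1 else 0)"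
proof (cases "u = 0")
  case True
  then show ?thesis by simp
next
  case u0: False
  let ?n = "CARD('a) - 1"
  have n: "?n > 0" using card_field_gt_1[where ?'a = 'a] by simp
  obtain g :: 'a where g0: "g \<noteq> 0" and bij: "bij_betw (\<lambda>i. g ^ i) {..<?n} (UNIV - {0})"
    by (rule finite_field_generator)
  have gn: "g ^ ?n = 1" by (rule finite_field_power_eq_1[OF g0])
  have gen: "\<exists>i<?n. x = g ^ i" if "x \<noteq> 0" for x
    using bij that by (auto simp: bij_betw_def image_iff set_eq_iff)
  have g_inj: "i mod ?n = j mod ?n" if "g ^ i = g ^ j" for i j
    using that bij n power_mod_exponent[OF gn, of i] power_mod_exponent[OF gn, of j]
    by (metis bij_betw_imp_inj_on inj_onD lessThan_iff mod_less_divisor)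
  \<comment> \<open>\<open>c z\<close> is meant to be the character sending \<open>g\<close> to
    \<open>z\<close>. The chosen exponent is determined only modulo \<open>?n\<close>, whence the
    condition \<open>z ^ ?n = 1\<close> in what follows.\<close>
  define c where "c z x = (if x = 0 then 0 else z ^ (SOME i. x = g ^ i))" for z :: complex and x :: 'a
  have c_g: "c z (g ^ i) = z ^ i" if "z ^ ?n = 1" for z i
  proof -
    have "g ^ i = g ^ (SOME j. g ^ i = g ^ j)" by (rule someI) (rule refl)
    then have "i mod ?n = (SOME j. g ^ i = g ^ j) mod ?n" by (rule g_inj)
    then show ?thesis
      using g0 power_mod_exponent[OF that] by (metis c_def power_not_zero)
  qed
  have c_char: "mult_char (c z)" if z: "z ^ ?n = 1" for z
  proof -
    have "c z (x * y) = c z x * c z y" for x y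
    proof (cases "x = 0 \<or> y = 0")
      case True
      then show ?thesis by (auto simp: c_def)
    next
      case False
      then obtain i j where "x = g ^ i" "y = g ^ j" using gen by metis
      then show ?thesis using c_g[OF z] by (simp flip: power_add)
    qed
    then show ?thesis
      using c_g[OF z, of 0] by (simp add: mult_char_def c_def)
  qed
  have c_eval: "c (\<chi> g) = \<chi>" if "mult_char \<chi>" for \<chi>
  proof
    fix x
    show "c (\<chi> g) x = \<chi> x"
    proof (cases "x = 0")
      case False
      then obtain i where "x = g ^ i" using gen by metis
      then show ?thesis
        using c_g[OF mult_char_power_card[OF that g0]] that by (simp add: mult_char_power)
    qed (use that in \<open>simp add: c_def\<close>)
  qed
  have "bij_betw c {z. z ^ ?n = 1} {\<chi>. mult_char \<chi>}"
    by (rule bij_betw_byWitness[where f' = "\<lambda>\<chi>. \<chi> g"])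
       (use c_char c_eval c_g[of _ 1] mult_char_power_card[OF _ g0] in auto)
  then have "(\<Sum>\<chi> | mult_char \<chi>. \<chi> u) = (\<Sum>z | z ^ ?n = 1. c z u)"
    by (simp add: sum.reindex_bij_betw[where g = "\<lambda>\<chi>. \<chi> u", symmetric])
  also obtain i where i: "i < ?n" "u = g ^ i" using gen[OF u0] by metis
  have "(\<Sum>z | z ^ ?n = 1. c z u) = (\<Sum>z | z ^ ?n = 1. z ^ i)"
    using i c_g by (intro sum.cong) auto
  also have "\<dots> = (\<Sum>k<?n. cis (2 * pi * real k / real ?n) ^ i)"
    by (rule sum.reindex_bij_betw[OF bij_betw_roots_unity[OF n], symmetric])
  \<comment> \<open>The angle is symmetric in \<open>i\<close> and \<open>k\<close>; exchanging them
    makes the sum geometric in \<open>k\<close>.\<close>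
  also have "\<dots> = (\<Sum>k<?n. cis (2 * pi * real i / real ?n) ^ k)"
    by (simp add: DeMoivre mult_ac)
  also have "\<dots> = (if i = 0 then of_nat ?n else 0)"
  proof (cases "i = 0")
    case False
    let ?z = "cis (2 * pi * real i / real ?n)"
    have z: "?z \<in> {z. z ^ ?n = 1}"
      using bij_betw_roots_unity[OF n] i by (auto simp: bij_betw_def)
    have "?z \<noteq> cis (2 * pi * real 0 / real ?n)"
      using bij_betw_roots_unity[OF n] i False n unfolding bij_betw_def inj_on_def by blast
    then have "?z \<noteq> 1" by simp
    with False z show ?thesis by (simp add: geometric_sum)
  qed simp
  also have "i = 0 \<longleftrightarrow> u = 1"
    using g_inj[of i 0] i n by auto
  finally show ?thesis using n by (simp add: of_nat_diff)
qed

section \<open>Greene's function as a single sum over the field\<close>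

text \<open>Conjugation inverts character values, so the substitution \<open>u = y / (1 - y)\<close>
  merges the two values of \<chi> into one and isolates the dependence on \<chi>.\<close>

lemma greene_binom_mult_char:
  fixes A \<chi> :: "'a::{field,finite} \<Rightarrow> complex"
  assumes A0: "A 0 = 0" and \<chi>: "mult_char \<chi>"
  shows "greene_binom (\<lambda>y. A y * \<chi> y) \<chi> =
    \<chi> (-1) / of_nat CARD('a) * (\<Sum>u\<in>UNIV. A (u / (1 + u)) * \<chi> u)"
proof -
  have "(\<Sum>y\<in>UNIV. A y * \<chi> y * cnj (\<chi> (1 - y))) = (\<Sum>y\<in>UNIV - {1}. A y * \<chi> (y / (1 - y)))"
    using \<chi> by (intro sum.mono_neutral_cong_right)
      (auto simp: mult_char_mult mult_char_inverse mult_char_cnj divide_inverse)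
  also have "\<dots> = (\<Sum>u\<in>UNIV - {-1}. A (u / (1 + u)) * \<chi> u)"
  proof (rule sum.reindex_bij_witness[where i = "\<lambda>u. u / (1 + u)" and j = "\<lambda>y. y / (1 - y)"])
    fix y :: 'a assume "y \<in> UNIV - {1}"
    then have y: "1 - y \<noteq> 0" by auto
    have *: "1 + y / (1 - y) = 1 / (1 - y)" using y by (simp add: field_simps)
    show **: "y / (1 - y) / (1 + y / (1 - y)) = y" using y unfolding * by simp
    show "y / (1 - y) \<in> UNIV - {-1}"
      using y by (auto simp: divide_eq_eq)
    show "A (y / (1 - y) / (1 + y / (1 - y))) * \<chi> (y / (1 - y)) = A y * \<chi> (y / (1 - y))"
      unfolding ** ..
  next
    fix u :: 'a assume "u \<in> UNIV - {-1}"
    then have u: "1 + u \<noteq> 0" by (metis DiffE add_eq_0_iff singletonI)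
    have *: "1 - u / (1 + u) = 1 / (1 + u)" using u by (simp add: field_simps)
    show "u / (1 + u) / (1 - u / (1 + u)) = u" using u unfolding * by simp
    show "u / (1 + u) \<in> UNIV - {1}"
      using u by (auto simp: divide_eq_eq)
  qed
  \<comment> \<open>At \<open>u = -1\<close> division by zero gives \<open>0\<close>, so this term
    vanishes by \<open>A 0 = 0\<close>.\<close>
  also have "\<dots> = (\<Sum>u\<in>UNIV. A (u / (1 + u)) * \<chi> u)"
    using A0 by (intro sum.mono_neutral_left) auto
  finally show ?thesis by (simp add: greene_binom_def)
qed

text \<open>The product of the two coefficients is a double sum over \<open>u\<close> and
  \<open>v\<close>. The signs \<chi>(-1) cancel, and orthogonality keeps only the pairs with
  \<open>u * v * t = 1\<close>.\<close>

lemma greene_2F1_trivial_char: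
  fixes A B :: "'a::{field,finite} \<Rightarrow> complex"
  assumes A0: "A 0 = 0" and B0: "B 0 = 0" and t: "t \<noteq> 0"
  shows "greene_2F1 A B trivial_char t =
    (\<Sum>u\<in>UNIV. A (u / (1 + u)) * B (1 / (1 + t * u))) / of_nat CARD('a)"
proof -
  define q :: complex where "q = of_nat CARD('a)"
  have q: "q \<noteq> 0" "q - 1 \<noteq> 0"
    using card_field_gt_1[where ?'a = 'a] by (auto simp: q_def)
  have summand: "greene_binom (\<lambda>y. A y * \<chi> y) \<chi> *
      greene_binom (\<lambda>y. B y * \<chi> y) (\<lambda>y. trivial_char y * \<chi> y) * \<chi> t =
      (\<Sum>u\<in>UNIV. \<Sum>v\<in>UNIV. A (u / (1 + u)) * B (v / (1 + v)) * \<chi> (u * v * t)) / q\<^sup>2"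
    if \<chi>: "mult_char \<chi>" for \<chi>
  proof -
    have "(\<lambda>y. trivial_char y * \<chi> y) = \<chi>"
      using \<chi> by (auto simp: trivial_char_def fun_eq_iff)
    moreover have "\<chi> (-1) * \<chi> (-1) = 1"
      using \<chi> by (simp flip: mult_char_mult)
    moreover define S T where "S = (\<Sum>u\<in>UNIV. A (u / (1 + u)) * \<chi> u)"
      and "T = (\<Sum>v\<in>UNIV. B (v / (1 + v)) * \<chi> v)"
    ultimately have "greene_binom (\<lambda>y. A y * \<chi> y) \<chi> *
        greene_binom (\<lambda>y. B y * \<chi> y) (\<lambda>y. trivial_char y * \<chi> y) * \<chi> t =
        (\<chi> (-1) * \<chi> (-1)) * (S * T * \<chi> t) / q\<^sup>2"
      using \<chi> A0 B0 by (simp only: greene_binom_mult_char flip: q_def) (simp add: power2_eq_square)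
    also have "S * T * \<chi> t =
        (\<Sum>u\<in>UNIV. \<Sum>v\<in>UNIV. A (u / (1 + u)) * B (v / (1 + v)) * \<chi> (u * v * t))"
      unfolding S_def T_def sum_product
      using \<chi> by (simp add: mult_char_mult sum_distrib_left mult_ac)
    finally show ?thesis using \<open>\<chi> (-1) * \<chi> (-1) = 1\<close> by simp
  qed
  have inner: "(\<Sum>v\<in>UNIV. A (u / (1 + u)) * B (v / (1 + v)) * (if u * v * t = 1 then q - 1 else 0)) =
      (q - 1) * (A (u / (1 + u)) * B (1 / (1 + t * u)))" for u
  proof (cases "u = 0")
    case False
    have iff: "u * v * t = 1 \<longleftrightarrow> v = 1 / (t * u)" for v
      using False t by (auto simp: field_simps)
    have "1 + 1 / (t * u) = (1 + t * u) / (t * u)"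
      using False t by (simp add: field_simps)
    \<comment> \<open>This includes the case \<open>1 + t * u = 0\<close>, where both sides are
      divisions by zero with value \<open>0\<close>.\<close>
    then have "1 / (t * u) / (1 + 1 / (t * u)) = 1 / (1 + t * u)"
      using False t by simp
    then show ?thesis
      by (simp add: iff if_distrib cong: if_cong)
  qed (use A0 in simp)
  have "greene_2F1 A B trivial_char t = q / (q - 1) *
      (\<Sum>\<chi> | mult_char \<chi>. (\<Sum>u\<in>UNIV. \<Sum>v\<in>UNIV. A (u / (1 + u)) * B (v / (1 + v)) * \<chi> (u * v * t)) / q\<^sup>2)"
    unfolding greene_2F1_def q_def[symmetric]
    by (rule arg_cong[where f = "\<lambda>s. q / (q - 1) * s"]) (auto intro!: sum.cong summand)
  also have "\<dots> = q / (q - 1) / q\<^sup>2 *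
      (\<Sum>u\<in>UNIV. \<Sum>v\<in>UNIV. A (u / (1 + u)) * B (v / (1 + v)) * (\<Sum>\<chi> | mult_char \<chi>. \<chi> (u * v * t)))"
    unfolding sum_divide_distrib[symmetric] sum_distrib_left[of "A _ * B _"]
    by (subst sum.swap, subst sum.swap[where A = "{\<chi>. mult_char \<chi>}"]) simp
  also have "\<dots> = q / (q - 1) / q\<^sup>2 *
      ((q - 1) * (\<Sum>u\<in>UNIV. A (u / (1 + u)) * B (1 / (1 + t * u))))"
    by (simp only: sum_mult_chars inner sum_distrib_left flip: q_def)
  also have "\<dots> = (\<Sum>u\<in>UNIV. A (u / (1 + u)) * B (1 / (1 + t * u))) / q"
    using q by (simp add: power2_eq_square)
  finally show ?thesis by (simp add: q_def)
qed

section \<open>The quadratic character and root counting\<close>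

text \<open>Serves substitutions that are not injective: if \<open>F x\<close> depends on
  \<open>f x\<close> alone, the inner sum is a fibre count.\<close>

lemma sum_fibres:
  fixes f :: "'a::finite \<Rightarrow> 'b::finite"
  shows "(\<Sum>x\<in>S. F x) = (\<Sum>y\<in>UNIV. \<Sum>x | x \<in> S \<and> f x = y. F x)"
  by (rule sum.group[symmetric]) auto

text \<open>A nonsquare is an odd power of a generator, so two nonsquares multiply to an even power,
  and a nonzero square factor does not affect being a square.\<close>

lemma mult_char_quadratic_char [simp]: "mult_char (quadratic_char :: 'a::{field,finite} \<Rightarrow> complex)"
proof -
  obtain g :: 'a where bij: "bij_betw (\<lambda>i. g ^ i) {..<CARD('a) - 1} (UNIV - {0})"
    by (rule finite_field_generator)
  have odd_power: "\<exists>i. odd i \<and> x = g ^ i" if "x \<noteq> 0" "\<nexists>z. x = z\<^sup>2" for x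
  proof -
    obtain i where i: "x = g ^ i"
      using bij \<open>x \<noteq> 0\<close> by (auto simp: bij_betw_def image_iff set_eq_iff)
    have "odd i"
    proof
      assume "even i"
      then have "x = (g ^ (i div 2))\<^sup>2" using i by (simp flip: power_mult)
      with that(2) show False by blast
    qed
    with i show ?thesis by blast
  qed
  have nonsquares: "\<exists>z. x * y = z\<^sup>2"
    if xy: "x \<noteq> 0" "y \<noteq> 0" "\<nexists>z. x = z\<^sup>2" "\<nexists>z. y = z\<^sup>2" for x y :: 'a
  proof -
    obtain i j where "odd i" "x = g ^ i" "odd j" "y = g ^ j"
      using odd_power[OF xy(1,3)] odd_power[OF xy(2,4)] by blast
    then have "x * y = (g ^ ((i + j) div 2))\<^sup>2" by (simp flip: power_mult power_add)
    then show ?thesis ..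
  qed
  have square_right: "(\<exists>z. x * y\<^sup>2 = z\<^sup>2) \<longleftrightarrow> (\<exists>z. x = z\<^sup>2)" if "y \<noteq> 0" for x y :: 'a
  proof
    assume "\<exists>z. x * y\<^sup>2 = z\<^sup>2"
    then obtain z where "x * y\<^sup>2 = z\<^sup>2" ..
    then have "x = (z / y)\<^sup>2" using that by (simp add: power_divide eq_divide_eq)
    then show "\<exists>z. x = z\<^sup>2" ..
  qed (metis power_mult_distrib)
  have "quadratic_char (x * y) = quadratic_char x * quadratic_char y" for x y :: 'a
  proof (cases "x = 0 \<or> y = 0")
    case False
    then show ?thesis
      using nonsquares[of x y] square_right[of _ x] square_right[of _ y]
      by (auto simp: quadratic_char_def mult.commute)
  qed (auto simp: quadratic_char_def)
  moreover have "\<exists>y::'a. 1 = y\<^sup>2" by (rule exI[of _ 1]) simp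
  ultimately show ?thesis by (simp add: mult_char_def quadratic_char_def)
qed

lemma quadratic_char_square: "x \<noteq> 0 \<Longrightarrow> quadratic_char (x\<^sup>2) = 1"
  by (auto simp: quadratic_char_def)

lemma quadratic_char_cases: "x \<noteq> 0 \<Longrightarrow> quadratic_char x = 1 \<or> quadratic_char x = -1"
  by (simp add: quadratic_char_def)

lemma quadratic_char_sq: "x \<noteq> 0 \<Longrightarrow> (quadratic_char x)\<^sup>2 = 1"
  by (simp add: quadratic_char_def)

lemma quadratic_char_square_mult: "x \<noteq> 0 \<Longrightarrow> quadratic_char (x\<^sup>2 * y) = quadratic_char y"
  by (simp add: mult_char_mult quadratic_char_square)

text \<open>Squaring identifies the distinct elements 1 and -1, so on a finite field it is not
  surjective.\<close>

lemma ex_nonsquare: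
  assumes "(2::'a::{field,finite}) \<noteq> 0"
  obtains v :: "'a::{field,finite}" where "v \<noteq> 0" and "quadratic_char v = -1"
proof -
  have "\<not> inj (\<lambda>y::'a. y\<^sup>2)"
  proof
    assume "inj (\<lambda>y::'a. y\<^sup>2)"
    then have "(1::'a) = -1" by (rule injD) simp
    then have "(2::'a) = 0" by (metis add.right_inverse one_add_one)
    with assms show False ..
  qed
  then have "\<not> surj (\<lambda>y::'a. y\<^sup>2)" by (metis finite_UNIV_surj_inj finite)
  then obtain v :: 'a where "\<nexists>y. v = y\<^sup>2" by (auto simp: surj_def)
  moreover from this have "v \<noteq> 0" by (metis zero_power2)
  ultimately show ?thesis using that by (simp add: quadratic_char_def)
qed

text \<open>Multiplication by \<open>v\<close> permutes the field and scales the sum by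
  \<chi>(v).\<close>

lemma sum_mult_char_eq_0:
  fixes \<chi> :: "'a::{field,finite} \<Rightarrow> complex"
  assumes \<chi>: "mult_char \<chi>" and v: "v \<noteq> 0" "\<chi> v \<noteq> 1"
  shows "(\<Sum>x\<in>UNIV. \<chi> x) = 0"
proof -
  have "(\<Sum>x\<in>UNIV. \<chi> x) = (\<Sum>x\<in>UNIV. \<chi> (v * x))"
    by (rule sum.reindex_bij_witness[where i = "\<lambda>x. v * x" and j = "\<lambda>x. x / v"]) (use v in auto)
  also have "\<dots> = \<chi> v * (\<Sum>x\<in>UNIV. \<chi> x)"
    using \<chi> by (simp add: mult_char_mult sum_distrib_left)
  finally show ?thesis using v by (metis mult_cancel_right1)
qed

lemma sum_quadratic_char:
  assumes "(2::'a::{field,finite}) \<noteq> 0"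
  shows "(\<Sum>x\<in>UNIV. quadratic_char (x + a :: 'a)) = 0"
proof -
  obtain v :: 'a where "v \<noteq> 0" "quadratic_char v = -1"
    using ex_nonsquare[OF assms] .
  then have "(\<Sum>x\<in>UNIV. quadratic_char (x :: 'a)) = 0"
    using sum_mult_char_eq_0[OF mult_char_quadratic_char, of v] by simp
  moreover have "(\<Sum>x\<in>UNIV. quadratic_char (x + a)) = (\<Sum>x\<in>UNIV. quadratic_char (x :: 'a))"
    by (rule sum.reindex_bij_witness[where i = "\<lambda>x. x - a" and j = "\<lambda>x. x + a"]) auto
  ultimately show ?thesis by simp
qed

lemma card_square_roots:
  fixes w :: "'a::{field,finite}"
  assumes "(2::'a) \<noteq> 0"
  shows "of_nat (card {s. s\<^sup>2 = w}) = 1 + quadratic_char w"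
proof (cases "w = 0")
  case True
  then show ?thesis by (simp add: quadratic_char_def)
next
  case w: False
  show ?thesis
  proof (cases "\<exists>s. w = s\<^sup>2")
    case True
    then obtain s where s: "w = s\<^sup>2" ..
    have "s \<noteq> -s"
    proof
      assume "s = -s"
      then have "2 * s = 0" by (metis add.right_inverse mult_2)
      with assms w s show False by simp
    qed
    moreover have "{z. z\<^sup>2 = w} = {s, -s}" by (auto simp: s power2_eq_iff)
    ultimately show ?thesis using w True by (simp add: quadratic_char_def)
  next
    case False
    then have "{s. s\<^sup>2 = w} = {}" by auto
    with w False show ?thesis by (simp add: quadratic_char_def)
  qed
qed

text \<open>Completing the square: \<open>2 * a * u + b\<close> runs through the square roots of the
  discriminant.\<close>

lemma card_quadratic_roots:
  fixes a b c :: "'a::{field,finite}"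
  assumes 2: "(2::'a) \<noteq> 0" and a: "a \<noteq> 0"
  shows "of_nat (card {u. a * u\<^sup>2 + b * u + c = 0}) = 1 + quadratic_char (b\<^sup>2 - 4 * a * c)"
proof -
  have "(4::'a) = 2 * 2" by simp
  then have 4: "(4::'a) \<noteq> 0" using 2 by (metis mult_eq_0_iff)
  have key: "(2 * a * u + b)\<^sup>2 - (b\<^sup>2 - 4 * a * c) = 4 * a * (a * u\<^sup>2 + b * u + c)" for u
    by (simp add: power2_eq_square algebra_simps)
  have iff: "a * u\<^sup>2 + b * u + c = 0 \<longleftrightarrow> (2 * a * u + b)\<^sup>2 = b\<^sup>2 - 4 * a * c" for u
    using a 4 by (subst eq_iff_diff_eq_0, subst key) simp
  have "bij_betw (\<lambda>u. 2 * a * u + b) {u. a * u\<^sup>2 + b * u + c = 0} {s. s\<^sup>2 = b\<^sup>2 - 4 * a * c}"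
    unfolding iff
    by (rule bij_betw_byWitness[where f' = "\<lambda>s. (s - b) / (2 * a)"]) (use 2 a in auto)
  then show ?thesis
    using card_square_roots[OF 2] by (simp add: bij_betw_same_card)
qed

section \<open>The substitution m = n + b/n and the 2-isogeny\<close>

text \<open>Zero is not a root of the quadratic as \<open>b\<close> is nonzero, so clearing the
  denominator adds no solution. The coefficients \<open>1\<close> and \<open>-m\<close> are spelled
  out to match \<open>card_quadratic_roots\<close>.\<close>

lemma add_divide_eq_iff_quadratic:
  fixes b m n :: "'a::field"
  assumes "b \<noteq> 0"
  shows "n \<noteq> 0 \<and> n + b / n = m \<longleftrightarrow> 1 * n\<^sup>2 + (-m) * n + b = 0"
proof (cases "n = 0")
  case False
  then have "1 * n\<^sup>2 + (-m) * n + b = n * (n + b / n - m)"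
    by (simp add: power2_eq_square algebra_simps)
  with False show ?thesis by simp
qed (use assms in simp)

text \<open>The point-count form of the 2-isogeny from \<open>y\<^sup>2 = x (x\<^sup>2 + a x + b)\<close> to
  \<open>y\<^sup>2 = x (x\<^sup>2 - 2 a x + a\<^sup>2 - 4 b)\<close>, with the second curve written in \<open>m = x - a\<close>.\<close>

lemma sum_quadratic_char_isogeny:
  fixes a b :: "'a::{field,finite}"
  assumes 2: "(2::'a) \<noteq> 0" and b: "b \<noteq> 0"
  shows "(\<Sum>n\<in>UNIV. quadratic_char (n * (n\<^sup>2 + a * n + b))) =
    (\<Sum>m\<in>UNIV. quadratic_char (m + a) * quadratic_char (m\<^sup>2 - 4 * b))"
proof -
  let ?\<phi> = "quadratic_char :: 'a \<Rightarrow> complex"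
  have "(\<Sum>n\<in>UNIV. ?\<phi> (n * (n\<^sup>2 + a * n + b))) = (\<Sum>n\<in>UNIV - {0}. ?\<phi> (n + b / n + a))"
  proof (rule sum.mono_neutral_cong_right)
    fix n assume "n \<in> UNIV - {0::'a}"
    then have n: "n \<noteq> 0" by simp
    then have "n * (n\<^sup>2 + a * n + b) = n\<^sup>2 * (n + b / n + a)"
      by (simp add: power2_eq_square field_simps)
    then show "?\<phi> (n * (n\<^sup>2 + a * n + b)) = ?\<phi> (n + b / n + a)"
      using n by (simp add: quadratic_char_square_mult)
  qed auto
  \<comment> \<open>The summand depends only on \<open>m = n + b / n\<close>, and the discriminant
    \<open>m\<^sup>2 - 4 * b\<close> counts the \<open>n\<close> above each
    \<open>m\<close>.\<close>
  also have "\<dots> = (\<Sum>m\<in>UNIV. \<Sum>n | n \<in> UNIV - {0} \<and> n + b / n = m. ?\<phi> (n + b / n + a))"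
    by (rule sum_fibres)
  also have "\<dots> = (\<Sum>m\<in>UNIV. ?\<phi> (m + a) * (1 + ?\<phi> (m\<^sup>2 - 4 * b)))"
  proof (rule sum.cong[OF refl])
    fix m
    have "{n \<in> UNIV - {0}. n + b / n = m} = {n. 1 * n\<^sup>2 + (-m) * n + b = 0}"
      using add_divide_eq_iff_quadratic[OF b] by simp
    then have "of_nat (card {n \<in> UNIV - {0}. n + b / n = m}) = 1 + ?\<phi> (m\<^sup>2 - 4 * b)"
      using card_quadratic_roots[OF 2, of 1 "-m" b] by simp
    moreover have "(\<Sum>n | n \<in> UNIV - {0} \<and> n + b / n = m. ?\<phi> (n + b / n + a)) =
        of_nat (card {n \<in> UNIV - {0}. n + b / n = m}) * ?\<phi> (m + a)"
      by simp
    ultimately show "(\<Sum>n | n \<in> UNIV - {0} \<and> n + b / n = m. ?\<phi> (n + b / n + a)) =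
        ?\<phi> (m + a) * (1 + ?\<phi> (m\<^sup>2 - 4 * b))"
      by (simp add: mult.commute)
  qed
  \<comment> \<open>The summand 1 of the root count contributes a full sum of \<phi>, which is
    zero.\<close>
  also have "\<dots> = (\<Sum>m\<in>UNIV. ?\<phi> (m + a) * ?\<phi> (m\<^sup>2 - 4 * b))"
    using sum_quadratic_char[OF 2, of a] by (simp add: distrib_left sum.distrib)
  finally show ?thesis .
qed

text \<open>Since \<open>(s + 1)\<^sup>2 = s (m + 2)\<close> and \<open>(s - 1)\<^sup>2 = s (m - 2)\<close>, the value of the character at \<open>s\<close>
  depends only on \<open>m\<close>.\<close>

lemma sum_quadratic_char_add_inverse:
  fixes m :: "'a::{field,finite}"
  assumes 2: "(2::'a) \<noteq> 0" and minus1: "quadratic_char (-1 :: 'a) = 1"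
  shows "(\<Sum>s | s \<noteq> 0 \<and> s + 1 / s = m. quadratic_char s) = quadratic_char (m + 2) + quadratic_char (m - 2)"
proof -
  let ?\<phi> = "quadratic_char :: 'a \<Rightarrow> complex"
  have eq: "s \<noteq> 0 \<and> s + 1 / s = m \<longleftrightarrow> 1 * s\<^sup>2 + (-m) * s + 1 = 0" for s
    by (rule add_divide_eq_iff_quadratic) simp
  show ?thesis
  \<comment> \<open>For \<open>m = -2\<close> the only solution is \<open>s = -1\<close>, and the
    right-hand side is \<phi>(0) + \<phi>(-4).\<close>
  proof (cases "m + 2 = 0")
    case True
    then have m: "m = -2" by (simp add: eq_neg_iff_add_eq_0)
    have "1 * s\<^sup>2 + (-m) * s + 1 = (s + 1)\<^sup>2" for s
      by (simp add: m power2_eq_square algebra_simps)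
    then have "{s. s \<noteq> 0 \<and> s + 1 / s = m} = {-1}"
      unfolding eq by (auto simp: eq_neg_iff_add_eq_0)
    moreover have "m - 2 = 2\<^sup>2 * (-1)" by (simp add: m)
    then have "?\<phi> (m - 2) = 1"
      using 2 minus1 by (metis quadratic_char_square_mult)
    ultimately show ?thesis using True minus1 by simp
  next
    case False
    have "?\<phi> s = ?\<phi> (m + 2)" if s: "s \<noteq> 0" "s + 1 / s = m" for s
    proof -
      have "(s + 1)\<^sup>2 = s * (m + 2)"
        using s by (auto simp: field_simps power2_eq_square)
      moreover from this have "s + 1 \<noteq> 0" using s False by auto
      ultimately have "?\<phi> s * ?\<phi> (m + 2) = 1"
        by (metis mult_char_mult mult_char_quadratic_char quadratic_char_square)
      then show ?thesis
        using quadratic_char_cases[OF s(1)] quadratic_char_cases[OF False] by auto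
    qed
    then have "(\<Sum>s | s \<noteq> 0 \<and> s + 1 / s = m. ?\<phi> s) =
        of_nat (card {s. s \<noteq> 0 \<and> s + 1 / s = m}) * ?\<phi> (m + 2)"
      by simp
    also have "\<dots> = (1 + ?\<phi> (m\<^sup>2 - 4)) * ?\<phi> (m + 2)"
      unfolding eq using card_quadratic_roots[OF 2, of 1 "-m" 1] by simp
    \<comment> \<open>The factor \<phi>(m + 2) occurs squared in the second term, where it equals
      1.\<close>
    also have "m\<^sup>2 - 4 = (m + 2) * (m - 2)"
      by (simp add: power2_eq_square algebra_simps)
    also have "(1 + ?\<phi> ((m + 2) * (m - 2))) * ?\<phi> (m + 2) =
        ?\<phi> (m + 2) + (?\<phi> (m + 2))\<^sup>2 * ?\<phi> (m - 2)"
      by (simp only: mult_char_mult[OF mult_char_quadratic_char]) (simp add: power2_eq_square algebra_simps)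
    finally show ?thesis by (simp add: quadratic_char_sq[OF False])
  qed
qed

section \<open>Reduction of the quartic character sum to quadratic characters\<close>

lemma sum_quartic_char:
  fixes \<chi> :: "'a::{field,finite} \<Rightarrow> complex"
  assumes 2: "(2::'a) \<noteq> 0" and \<chi>: "mult_char \<chi>" and \<chi>2: "\<And>x. (\<chi> x)\<^sup>2 = quadratic_char x"
    and t: "t \<noteq> 0" "t \<noteq> 1"
  shows "(\<Sum>u\<in>UNIV. \<chi> (u * (1 + t * u) / (1 + u))) =
    (\<Sum>m\<in>UNIV. quadratic_char (m + 2) * quadratic_char (m\<^sup>2 - 4 * (1 - t)))"
proof -
  let ?\<phi> = "quadratic_char :: 'a \<Rightarrow> complex"
  define S where "S = (\<Sum>u\<in>UNIV. \<chi> (u * (1 + t * u) / (1 + u)))"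
  \<comment> \<open>\<open>G\<close> is invariant under inversion, and
    \<open>G (s\<^sup>2) = H (s + 1 / s)\<close> for nonzero \<open>s\<close>.\<close>
  define G where "G w = ?\<phi> (w + inverse w + (4 * t - 2))" for w
  define H where "H m = ?\<phi> (m\<^sup>2 - 4 * (1 - t))" for m
  have \<chi>_square: "\<chi> (s\<^sup>2) = ?\<phi> s" for s
    using \<chi> by (simp add: mult_char_power \<chi>2)
  \<comment> \<open>Here \<phi>(-1) is \<chi> at the square of -1, that is \<chi>(1).\<close>
  have minus1: "?\<phi> (-1) = 1"
    using \<chi> \<chi>_square[of "-1"] by simp
  have cube: "(\<chi> w)^3 = \<chi> w * ?\<phi> w" for w
    by (simp add: power3_eq_cube power2_eq_square flip: \<chi>2)
  have \<chi>4: "\<chi> w * (\<chi> w)^3 = 1" if "w \<noteq> 0" for w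
  proof -
    have "\<chi> w * (\<chi> w)^3 = ((\<chi> w)\<^sup>2)\<^sup>2" by (simp add: eval_nat_numeral)
    with that show ?thesis by (simp add: \<chi>2 quadratic_char_sq)
  qed
  obtain v :: 'a where "v \<noteq> 0" "?\<phi> v = -1" using ex_nonsquare[OF 2] .
  then have sum0: "(\<Sum>w\<in>UNIV. \<chi> w) = 0"
    using \<chi>2[of v] by (intro sum_mult_char_eq_0[OF \<chi>]) auto

  have "S = (\<Sum>w\<in>UNIV. \<Sum>u | u \<in> UNIV \<and> u * (1 + t * u) / (1 + u) = w. \<chi> (u * (1 + t * u) / (1 + u)))"
    unfolding S_def by (rule sum_fibres)
  also have "\<dots> = (\<Sum>w\<in>UNIV. \<chi> w * (1 + ?\<phi> (w\<^sup>2 + (4 * t - 2) * w + 1)))"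
  proof (rule sum.cong[OF refl])
    fix w
    have "(\<Sum>u | u \<in> UNIV \<and> u * (1 + t * u) / (1 + u) = w. \<chi> (u * (1 + t * u) / (1 + u))) =
        of_nat (card {u. u * (1 + t * u) / (1 + u) = w}) * \<chi> w"
      by simp
    also have "\<dots> = \<chi> w * (1 + ?\<phi> (w\<^sup>2 + (4 * t - 2) * w + 1))"
    proof (cases "w = 0")
      case False
      have "u * (1 + t * u) / (1 + u) = w \<longleftrightarrow> t * u\<^sup>2 + (1 - w) * u + (-w) = 0" for u
      proof (cases "1 + u = 0")
        case True
        then have u: "u = -1" by (simp add: eq_neg_iff_add_eq_0 add.commute)
        \<comment> \<open>At \<open>u = -1\<close> the quotient is \<open>0\<close> by convention
          and differs from \<open>w\<close>, while the quadratic takes the nonzero value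
          \<open>t - 1\<close>.\<close>
        show ?thesis using False t by (simp add: u)
      next
        case nz: False
        have "u * (1 + t * u) / (1 + u) = w \<longleftrightarrow> u * (1 + t * u) = w * (1 + u)"
          using nz by (simp add: divide_eq_eq)
        also have "\<dots> \<longleftrightarrow> t * u\<^sup>2 + (1 - w) * u + (-w) = 0"
          by (simp add: eq_iff_diff_eq_0[of "u * (1 + t * u)"] power2_eq_square algebra_simps)
        finally show ?thesis .
      qed
      then have "of_nat (card {u. u * (1 + t * u) / (1 + u) = w}) =
          1 + ?\<phi> ((1 - w)\<^sup>2 - 4 * t * (-w))"
        using card_quadratic_roots[OF 2 t(1), of "1 - w" "-w"] by simp
      also have "(1 - w)\<^sup>2 - 4 * t * (-w) = w\<^sup>2 + (4 * t - 2) * w + 1"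
        by (simp add: power2_eq_square algebra_simps)
      finally show ?thesis by simp
    qed (use \<chi> in simp)
    finally show "(\<Sum>u | u \<in> UNIV \<and> u * (1 + t * u) / (1 + u) = w. \<chi> (u * (1 + t * u) / (1 + u))) =
        \<chi> w * (1 + ?\<phi> (w\<^sup>2 + (4 * t - 2) * w + 1))" .
  qed
  also have "\<dots> = (\<Sum>w\<in>UNIV. \<chi> w * ?\<phi> (w\<^sup>2 + (4 * t - 2) * w + 1))"
    using sum0 by (simp add: distrib_left sum.distrib)
  also have "\<dots> = (\<Sum>w\<in>UNIV. (\<chi> w)^3 * G w)"
  proof (rule sum.cong[OF refl])
    fix w
    show "\<chi> w * ?\<phi> (w\<^sup>2 + (4 * t - 2) * w + 1) = (\<chi> w)^3 * G w"
    proof (cases "w = 0")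
      case False
      then have "w\<^sup>2 + (4 * t - 2) * w + 1 = w * (w + inverse w + (4 * t - 2))"
        by (simp add: power2_eq_square algebra_simps)
      then show ?thesis
        by (simp add: G_def cube mult_char_mult)
    qed (use \<chi> in simp)
  qed
  finally have S1: "S = (\<Sum>w\<in>UNIV. (\<chi> w)^3 * G w)" .
  \<comment> \<open>Inversion of \<open>w\<close> exchanges \<chi> with its cube, the inverse
    character, and fixes \<open>G\<close>.\<close>
  also have "\<dots> = (\<Sum>w\<in>UNIV. \<chi> w * G w)"
  proof (rule sum.reindex_bij_witness[where i = inverse and j = inverse])
    fix w
    show "\<chi> (inverse w) * G (inverse w) = (\<chi> w)^3 * G w"
    proof (cases "w = 0")
      case False
      have "\<chi> (inverse w) = (\<chi> w)^3"
        using \<chi>4[OF False] \<chi> by (metis inverse_unique mult_char_inverse)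
      then show ?thesis by (simp add: G_def add.commute)
    qed (use \<chi> in simp)
  qed auto
  finally have S2: "S = (\<Sum>w\<in>UNIV. \<chi> w * G w)" .
  have "2 * S = (\<Sum>w\<in>UNIV. (\<chi> w)^3 * G w) + (\<Sum>w\<in>UNIV. \<chi> w * G w)"
    using S1 S2 by simp
  \<comment> \<open>The two weights add up to \<chi>(w) (1 + \<phi>(w)), whose second factor counts
    the square roots of \<open>w\<close>.\<close>
  also have "\<dots> = (\<Sum>w\<in>UNIV. of_nat (card {s. s\<^sup>2 = w}) * (\<chi> w * G w))"
    unfolding card_square_roots[OF 2]
    by (simp add: sum.distrib[symmetric] cube algebra_simps)
  also have "\<dots> = (\<Sum>w\<in>UNIV. \<Sum>s | s \<in> UNIV \<and> s\<^sup>2 = w. \<chi> (s\<^sup>2) * G (s\<^sup>2))"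
    by simp
  also have "\<dots> = (\<Sum>s\<in>UNIV. \<chi> (s\<^sup>2) * G (s\<^sup>2))"
    by (rule sum_fibres[symmetric])
  also have "\<dots> = (\<Sum>s\<in>UNIV - {0}. ?\<phi> s * H (s + 1 / s))"
  proof (rule sum.mono_neutral_cong_right)
    fix s :: 'a assume "s \<in> UNIV - {0}"
    then have "s\<^sup>2 + inverse (s\<^sup>2) + (4 * t - 2) = (s + 1 / s)\<^sup>2 - 4 * (1 - t)"
      by (simp add: power2_eq_square field_simps)
    then show "\<chi> (s\<^sup>2) * G (s\<^sup>2) = ?\<phi> s * H (s + 1 / s)"
      by (simp only: \<chi>_square G_def H_def)
  qed (use \<chi> in auto)
  also have "\<dots> = (\<Sum>m\<in>UNIV. \<Sum>s | s \<in> UNIV - {0} \<and> s + 1 / s = m. ?\<phi> s * H (s + 1 / s))"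
    by (rule sum_fibres)
  also have "\<dots> = (\<Sum>m\<in>UNIV. (\<Sum>s | s \<noteq> 0 \<and> s + 1 / s = m. ?\<phi> s) * H m)"
    by (simp add: sum_distrib_right)
  also have "\<dots> = (\<Sum>m\<in>UNIV. ?\<phi> (m + 2) * H m) + (\<Sum>m\<in>UNIV. ?\<phi> (m - 2) * H m)"
    by (simp add: sum_quadratic_char_add_inverse[OF 2 minus1] distrib_right sum.distrib)
  \<comment> \<open>\<open>H\<close> is even and \<phi>(-1) = 1, so both sums agree and the factor 2
    cancels.\<close>
  also have "(\<Sum>m\<in>UNIV. ?\<phi> (m - 2) * H m) = (\<Sum>m\<in>UNIV. ?\<phi> (m + 2) * H m)"
  proof (rule sum.reindex_bij_witness[where i = uminus and j = uminus])
    fix m :: 'a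
    have "-m + 2 = (-1) * (m - 2)" by simp
    then show "?\<phi> (-m + 2) * H (-m) = ?\<phi> (m - 2) * H m"
      using minus1 by (simp only: mult_char_mult[OF mult_char_quadratic_char] H_def) simp
  qed auto
  finally show ?thesis by (simp add: S_def H_def)
qed

section \<open>Consequences of having order 4\<close>

text \<open>In characteristic 2 squaring is additive and injective, hence surjective on a finite
  field.\<close>

lemma nonsquare_imp_two_neq_0:
  fixes v :: "'a::{field,finite}"
  assumes "quadratic_char v = -1"
  shows "(2::'a) \<noteq> 0"
proof
  assume 2: "(2::'a) = 0"
  have "inj (\<lambda>y::'a. y\<^sup>2)"
  proof (rule injI)
    fix y z :: 'a assume "y\<^sup>2 = z\<^sup>2"
    moreover have "(y - z)\<^sup>2 = y\<^sup>2 - z\<^sup>2 + 2 * (z\<^sup>2 - y * z)"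
      by (simp add: power2_eq_square algebra_simps)
    ultimately show "y = z" by (simp add: 2)
  qed
  then have "surj (\<lambda>y::'a. y\<^sup>2)" by (simp add: finite_UNIV_inj_surj)
  then have "\<exists>y. v = y\<^sup>2" by (simp add: surj_def)
  with assms show False by (auto simp: quadratic_char_def split: if_splits)
qed

text \<open>The square of \<chi> has values 1 and -1 on nonzero elements and is 1 on squares. Order
  4 yields a \<open>v\<close> where it is -1; every nonsquare times \<open>v\<close> is a square, so
  it is -1 on all nonsquares.\<close>

lemma char_order_4_square:
  fixes \<chi> :: "'a::{field,finite} \<Rightarrow> complex"
  assumes \<chi>: "mult_char \<chi>" and ord: "char_order \<chi> = 4"
  shows "(\<chi> x)\<^sup>2 = quadratic_char x" and "\<exists>v::'a. quadratic_char v = -1"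
proof -
  let ?P = "\<lambda>n. n > 0 \<and> (\<lambda>x. \<chi> x ^ n) = trivial_char"
  \<comment> \<open>A witness that the \<open>LEAST\<close> in \<open>char_order\<close> is
    attained.\<close>
  have "?P (CARD('a) - 1)"
    using card_field_gt_1[where ?'a = 'a] mult_char_power_card[OF \<chi>] \<chi>
    by (auto simp: fun_eq_iff trivial_char_def)
  then have "?P (char_order \<chi>)" unfolding char_order_def by (rule LeastI)
  then have pow4: "\<chi> x ^ 4 = 1" if "x \<noteq> 0" for x
    using that unfolding ord trivial_char_def by metis
  have "\<not> ?P 2"
    using not_less_Least[of 2 ?P] ord by (simp add: char_order_def)
  then obtain v where v: "v \<noteq> 0" "(\<chi> v)\<^sup>2 \<noteq> 1"
    using \<chi> by (auto simp: fun_eq_iff trivial_char_def split: if_splits)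
  have pm: "(\<chi> x)\<^sup>2 = 1 \<or> (\<chi> x)\<^sup>2 = -1" if "x \<noteq> 0" for x
  proof -
    have "((\<chi> x)\<^sup>2)\<^sup>2 = 1" using pow4[OF that] by (simp flip: power_mult)
    then show ?thesis unfolding power2_eq_1_iff .
  qed
  have square: "(\<chi> x)\<^sup>2 = 1" if x: "x \<noteq> 0" "quadratic_char x = 1" for x
  proof -
    obtain y where y: "x = y\<^sup>2" using x by (auto simp: quadratic_char_def split: if_splits)
    then have "(\<chi> x)\<^sup>2 = \<chi> y ^ 4" using \<chi> by (simp add: mult_char_power flip: power_mult)
    then show ?thesis using pow4 x y by auto
  qed
  have v': "quadratic_char v = -1" using square[of v] v quadratic_char_cases by blast
  then show "\<exists>v::'a. quadratic_char v = -1" ..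
  show "(\<chi> x)\<^sup>2 = quadratic_char x"
  proof (cases "x = 0")
    case True
    then show ?thesis using \<chi> by (simp add: quadratic_char_def)
  next
    case x: False
    show ?thesis
    proof (cases "quadratic_char x = 1")
      case False
      then have x': "quadratic_char x = -1" using x quadratic_char_cases by blast
      then have "(\<chi> (x * v))\<^sup>2 = 1"
        using x v v' by (intro square) (simp_all add: mult_char_mult)
      then have "(\<chi> x)\<^sup>2 * (\<chi> v)\<^sup>2 = 1"
        using \<chi> by (simp add: mult_char_mult power_mult_distrib)
      then show ?thesis using pm[OF v(1)] v(2) x' by (auto simp: minus_equation_iff)
    qed (use x square in simp)
  qed
qed

section \<open>Comparison of the two curves up to a quadratic twist\<close>

theorem theorem1p5:
  fixes p r :: nat
    and x :: "'a::{field,finite}"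
    and \<chi>4 :: "'a \<Rightarrow> complex"
  assumes "prime p" and "odd p" and "r \<ge> 1"
    and "CARD('a) = p ^ r"
    and "[CARD('a) = 1] (mod 4)"
    and "mult_char \<chi>4" and "char_order \<chi>4 = 4"
    and "x \<noteq> 0" and "x \<noteq> 1" and "x \<noteq> -1"
  shows "greene_2F1 \<chi>4 (\<lambda>y. \<chi>4 y ^ 3) trivial_char ((1 - x)\<^sup>2 / (1 + x)\<^sup>2) =
    quadratic_char (-2 :: 'a) * quadratic_char (1 + x) * greene_2F1 quadratic_char quadratic_char trivial_char x"
proof -
  let ?\<phi> = "quadratic_char :: 'a \<Rightarrow> complex"
  define t where "t = (1 - x)\<^sup>2 / (1 + x)\<^sup>2"
  note \<chi> = \<open>mult_char \<chi>4\<close>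
  have \<chi>2: "(\<chi>4 y)\<^sup>2 = ?\<phi> y" for y
    using char_order_4_square(1) \<chi> \<open>char_order \<chi>4 = 4\<close> by blast
  have minus1: "?\<phi> (-1) = 1"
    using \<chi> \<chi>2[of "-1"] by (metis mult_char_1 mult_char_power power2_minus power_one)
  have 2: "(2::'a) \<noteq> 0"
    using char_order_4_square(2)[OF \<chi> \<open>char_order \<chi>4 = 4\<close>] nonsquare_imp_two_neq_0 by blast
  have x1: "1 + x \<noteq> 0" using \<open>x \<noteq> -1\<close> by (simp add: eq_neg_iff_add_eq_0 add.commute)
  have t0: "t \<noteq> 0" using x1 \<open>x \<noteq> 1\<close> by (simp add: t_def)
  have t1: "1 - t = 4 * x / (1 + x)\<^sup>2"
    using x1 by (simp add: t_def field_simps) (simp add: power2_eq_square algebra_simps)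
  have "(4::'a) = 2 * 2" by simp
  then have 4: "(4::'a) \<noteq> 0" using 2 by (metis mult_eq_0_iff)
  have b0: "1 - t \<noteq> 0" using \<open>x \<noteq> 0\<close> x1 4 unfolding t1 by simp
  \<comment> \<open>The cube of \<chi>4 is its inverse, so the denominator \<open>1 + t * u\<close>
    moves into the numerator.\<close>
  have term4: "\<chi>4 (u / (1 + u)) * \<chi>4 (1 / (1 + t * u)) ^ 3 = \<chi>4 (u * (1 + t * u) / (1 + u))" for u
  proof (cases "1 + t * u = 0")
    case False
    have "\<chi>4 (1 + t * u) ^ 4 = 1"
      using quadratic_char_sq[OF False] unfolding \<chi>2[symmetric] by (simp flip: power_mult)
    then have "\<chi>4 (1 + t * u) * \<chi>4 (1 + t * u) ^ 3 = 1"
      by (simp add: eval_nat_numeral)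
    moreover have "\<chi>4 (1 + t * u) \<noteq> 0" using False \<chi> by (simp add: mult_char_eq_0_iff)
    ultimately have "\<chi>4 (1 / (1 + t * u)) ^ 3 = \<chi>4 (1 + t * u)"
      using \<chi> by (simp add: mult_char_divide power_divide divide_eq_eq)
    then show ?thesis using \<chi> by (simp add: mult_char_divide mult_char_mult)
  qed (use \<chi> in simp)
  have termphi: "?\<phi> (u / (1 + u)) * ?\<phi> (1 / (1 + x * u)) = ?\<phi> (u * (1 + u) * (1 + x * u))" for u
  proof -
    have inv: "?\<phi> (1 / y) = ?\<phi> y" for y
      using quadratic_char_cases[of y] by (cases "y = 0") (auto simp: mult_char_divide)
    have "?\<phi> (u / (1 + u)) * ?\<phi> (1 / (1 + x * u)) = ?\<phi> u * ?\<phi> (1 / (1 + u)) * ?\<phi> (1 / (1 + x * u))"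
      by (simp add: mult_char_divide)
    then show ?thesis unfolding inv by (simp add: mult_char_mult)
  qed
  define R where "R = (\<Sum>n\<in>UNIV. ?\<phi> (n * (n\<^sup>2 + (1 + x) * n + x)))"
  have "(\<Sum>u\<in>UNIV. ?\<phi> (u / (1 + u)) * ?\<phi> (1 / (1 + x * u))) = R"
    unfolding R_def termphi
  \<comment> \<open>With \<open>n = 1 / u\<close> the two cubics differ by the square factor
    \<open>(u\<^sup>2)\<^sup>2\<close>.\<close>
  proof (rule sum.reindex_bij_witness[where i = inverse and j = inverse])
    fix u
    show "?\<phi> (inverse u * ((inverse u)\<^sup>2 + (1 + x) * inverse u + x)) = ?\<phi> (u * (1 + u) * (1 + x * u))"
    proof (cases "u = 0")
      case False
      then have "u * (1 + u) * (1 + x * u) = (u\<^sup>2)\<^sup>2 * (inverse u * ((inverse u)\<^sup>2 + (1 + x) * inverse u + x))"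
        by (simp add: field_simps power2_eq_square)
      with False show ?thesis by (metis quadratic_char_square_mult power_not_zero)
    qed simp
  qed auto
  then have rhs: "greene_2F1 ?\<phi> ?\<phi> trivial_char x = R / of_nat CARD('a)"
    using \<open>x \<noteq> 0\<close> by (simp add: greene_2F1_trivial_char)
  have "(\<Sum>u\<in>UNIV. \<chi>4 (u / (1 + u)) * \<chi>4 (1 / (1 + t * u)) ^ 3) =
      (\<Sum>m\<in>UNIV. ?\<phi> (m + 2) * ?\<phi> (m\<^sup>2 - 4 * (1 - t)))"
    unfolding term4 using b0 by (intro sum_quartic_char 2 \<chi> \<chi>2 t0) auto
  \<comment> \<open>The isogeny with \<open>a = 2\<close> and \<open>b = 1 - t\<close>, read
    backwards.\<close>
  also have "\<dots> = (\<Sum>n\<in>UNIV. ?\<phi> (n * (n\<^sup>2 + 2 * n + (1 - t))))"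
    by (rule sum_quadratic_char_isogeny[OF 2 b0, symmetric])
  also have "\<dots> = (\<Sum>n\<in>UNIV. ?\<phi> 2 * ?\<phi> (1 + x) * ?\<phi> (n * (n\<^sup>2 + (1 + x) * n + x)))"
  \<comment> \<open>Since \<open>1 - t = 4 * x / (1 + x)\<^sup>2\<close>, this scaling carries one
    cubic to the other up to a square and the twist \<open>2 * (1 + x)\<close>, the source of the
    prefactor.\<close>
  proof (rule sum.reindex_bij_witness[where i = "\<lambda>n. 2 * n / (1 + x)" and j = "\<lambda>n. (1 + x) * n / 2"])
    fix n :: 'a
    define k where "k = (1 + x) * n / 2"
    have n: "n = 2 * k / (1 + x)" using x1 2 by (simp add: k_def)
    have nz: "2 / (1 + x)\<^sup>2 \<noteq> 0" using x1 2 by simp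
    have scale: "2 * k / a * ((2 * k / a)\<^sup>2 + 2 * (2 * k / a) + 4 * x / a\<^sup>2) =
        (2 / a\<^sup>2)\<^sup>2 * (2 * a * (k * (k\<^sup>2 + a * k + x)))" if "a \<noteq> 0" for a
      using that by (simp add: field_simps power2_eq_square)
    have "n * (n\<^sup>2 + 2 * n + (1 - t)) = (2 / (1 + x)\<^sup>2)\<^sup>2 * (2 * (1 + x) * (k * (k\<^sup>2 + (1 + x) * k + x)))"
      unfolding n t1 by (rule scale[OF x1])
    then show "?\<phi> 2 * ?\<phi> (1 + x) * ?\<phi> (k * (k\<^sup>2 + (1 + x) * k + x)) = ?\<phi> (n * (n\<^sup>2 + 2 * n + (1 - t)))"
      by (simp only: quadratic_char_square[OF nz] mult_1 mult_char_mult[OF mult_char_quadratic_char] mult.assoc)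
  qed (use x1 2 in auto)
  \<comment> \<open>\<phi>(2) = \<phi>(-2) because \<phi>(-1) = 1.\<close>
  also have "\<dots> = ?\<phi> (-2) * ?\<phi> (1 + x) * R"
    using minus1 mult_char_mult[OF mult_char_quadratic_char, of "-1" "2::'a"]
    by (simp add: R_def sum_distrib_left)
  finally have "(\<Sum>u\<in>UNIV. \<chi>4 (u / (1 + u)) * \<chi>4 (1 / (1 + t * u)) ^ 3) = ?\<phi> (-2) * ?\<phi> (1 + x) * R" .
  then have "greene_2F1 \<chi>4 (\<lambda>y. \<chi>4 y ^ 3) trivial_char t = ?\<phi> (-2) * ?\<phi> (1 + x) * R / of_nat CARD('a)"
    using t0 \<chi> by (simp add: greene_2F1_trivial_char)
  then show ?thesis by (simp add: rhs t_def)
qed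

end
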